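(* Let $A$ be an idiom and let $\mathcal{O}=\mathcal{O}(A)$ be the set of trivial intervals of $A$. For each ordinal $\alpha$, $$\mathcal{L}(\alpha)=\mathcal{G}ab^{\alpha}(\mathcal{O}).$$
   Context: An idiom is a complete, modular, upper-continuous lattice $A$ (upper-continuous: $a\wedge\bigvee X=\bigvee\{a\wedge x\mid x\in X\}$ for all $a\in A$ and directed $X\subseteq A$), with top $\bar 1$. For $a\le b$ in $A$ the interval is $[a,b]=\{x\in A\mid a\le x\le b\}$. $\mathcal{I}(A)$ is the set of all intervals and $\mathcal{O}(A)=\{[a,a]\mid a\in A\}$ the set of trivial intervals. Two intervals $I,J$ are similar, $J\sim I$, if there are $l,r\in A$ such that one of them is $[l,l\vee r]$ and the other is $[l\wedge r,r]$. $[a,b]$ is a subinterval of $[a',b']$ if $a'\le a\le b\le b'$. A set of intervals is abstract if it is nonempty and closed under $\sim$; basic if it is abstract and closed under subintervals; a congruence set if it is basic and $[a,b],[b,c]\in\mathcal{C}$ implies $[a,c]\in\mathcal{C}$; a pre-division set if it is basic and, for each $a\in A$ and $X\subseteq[a,\bar 1]$, if $[a,x]\in\mathcal{B}$ for all $x\in X$ then $[a,\bigvee X]\in\mathcal{B}$ (supremum taken in $[a,\bar 1]$); a division set if it is both a congruence set and a pre-division set. For a basic set $\mathcal{B}$, $\mathcal{D}vs(\mathcal{B})$ denotes the least division set containing $\mathcal{B}$. For a basic set $\mathcal{B}$, $\mathcal{C}rt(\mathcal{B})$ is the set of intervals $[a,b]$ such that for all $a\le x\le b$ one has $a=x$ or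 $[x,b]\in\mathcal{B}$ (it is again basic). Put $\mathcal{G}ab=\mathcal{D}vs\circ\mathcal{C}rt$ on basic sets. The iterates are $\mathcal{G}ab^0(\mathcal{O})=\mathcal{O}$, $\mathcal{G}ab^{\alpha+1}(\mathcal{O})=\mathcal{G}ab(\mathcal{G}ab^{\alpha}(\mathcal{O}))$, and $\mathcal{G}ab^{\lambda}(\mathcal{O})=\mathcal{D}vs\big(\bigcup\{\mathcal{G}ab^{\beta}(\mathcal{O})\mid\beta<\lambda\}\big)$ for limit $\lambda$. For $\mathcal{C}\subseteq\mathcal{I}(A)$, $(\forall\exists)(\mathcal{C})$ is the set of intervals $[a,b]$ such that for every $x$ with $a\le x<b$ there is $y$ with $x<y\le b$ and $[x,y]\in\mathcal{C}$. The sets $\mathcal{L}(\alpha),\mathcal{D}(\alpha),\mathcal{S}[\alpha]\subseteq\mathcal{I}(A)$ are defined by simultaneous transfinite recursion ($\alpha'$ is the successor of $\alpha$, $\lambda$ a limit ordinal): $\mathcal{L}(0)=\mathcal{D}(0)=\mathcal{O}(A)$; $[a,b]\in\mathcal{S}[\alpha]$ iff for all $x$ with $a<x\le b$: $[a,x]\notin\mathcal{L}(\alpha)$ and $[x,b]\in\mathcal{L}(\alpha)$; $\mathcal{D}(\alpha')=\mathcal{D}(\alpha)\cup\mathcal{S}[\alpha]$ and $\mathcal{L}(\alpha')=\mathcal{L}(\alpha)\cup(\forall\exists)(\mathcal{D}(\alpha'))$; $\mathcal{D}(\lambda)=\bigcup\{\mathcal{D}(\alpha)\mid\alpha<\lambda\}$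 and $\mathcal{L}(\lambda)=\bigcup\{\mathcal{L}(\alpha)\mid\alpha<\lambda\}\cup(\forall\exists)(\mathcal{D}(\lambda))$. *)

theory Defs
  imports Main
begin

section \<open>Idioms\<close>

class idiom = complete_lattice +
  assumes modular: "a \<le> c \<Longrightarrow> inf (sup a b) c = sup a (inf b c)"
    and upper_continuous: "X \<noteq> {} \<Longrightarrow> (\<And>x y. x \<in> X \<Longrightarrow> y \<in> X \<Longrightarrow> \<exists>z\<in>X. x \<le> z \<and> y \<le> z) \<Longrightarrow>
      inf a (Sup X) = Sup (inf a ` X)"

section \<open>Intervals\<close>

definition intervals :: "'a::idiom set set" where
  "intervals = {{a..b} | a b. a \<le> b}"

definition trivial_intervals :: "'a::idiom set set" where
  "trivial_intervals = {{a..a} | a. True}"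

definition similar :: "'a::idiom set \<Rightarrow> 'a set \<Rightarrow> bool" where
  "similar J I \<longleftrightarrow> (\<exists>l r. (J = {l..sup l r} \<and> I = {inf l r..r}) \<or>
                         (I = {l..sup l r} \<and> J = {inf l r..r}))"

definition subinterval :: "'a::idiom set \<Rightarrow> 'a set \<Rightarrow> bool" where
  "subinterval J I \<longleftrightarrow>
     (\<exists>a b a' b'. J = {a..b} \<and> I = {a'..b'} \<and> a' \<le> a \<and> a \<le> b \<and> b \<le> b')"

definition abstract_set :: "'a::idiom set set \<Rightarrow> bool" where
  "abstract_set C \<longleftrightarrow> C \<subseteq> intervals \<and> C \<noteq> {} \<and> (\<forall>I\<in>C. \<forall>J. similar J I \<longrightarrow> J \<in> C)"

definition basic_set :: "'a::idiom set set \<Rightarrow> bool" where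
  "basic_set C \<longleftrightarrow> abstract_set C \<and> (\<forall>I\<in>C. \<forall>J. subinterval J I \<longrightarrow> J \<in> C)"

definition congruence_set :: "'a::idiom set set \<Rightarrow> bool" where
  "congruence_set C \<longleftrightarrow> basic_set C \<and>
     (\<forall>a b c. a \<le> b \<and> b \<le> c \<and> {a..b} \<in> C \<and> {b..c} \<in> C \<longrightarrow> {a..c} \<in> C)"

text \<open>The supremum of \<open>X\<close> in the upper section \<open>{a..}\<close> is \<open>sup a (Sup X)\<close>; this differs
  from \<open>Sup X\<close> only for empty \<open>X\<close>, where it is \<open>a\<close>.\<close>

definition pre_division_set :: "'a::idiom set set \<Rightarrow> bool" where
  "pre_division_set B \<longleftrightarrow> basic_set B \<and>
     (\<forall>a X. X \<subseteq> {a..} \<and> (\<forall>x\<in>X. {a..x} \<in> B) \<longrightarrow> {a..sup a (Sup X)} \<in> B)"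

definition division_set :: "'a::idiom set set \<Rightarrow> bool" where
  "division_set D \<longleftrightarrow> congruence_set D \<and> pre_division_set D"

definition Dvs :: "'a::idiom set set \<Rightarrow> 'a set set" where
  "Dvs B = (LEAST D. division_set D \<and> B \<subseteq> D)"

definition Crt :: "'a::idiom set set \<Rightarrow> 'a set set" where
  "Crt B = {{a..b} | a b. a \<le> b \<and> (\<forall>x. a \<le> x \<and> x \<le> b \<longrightarrow> a = x \<or> {x..b} \<in> B)}"

definition Gab :: "'a::idiom set set \<Rightarrow> 'a set set" where
  "Gab = Dvs \<circ> Crt"

definition forall_exists :: "'a::idiom set set \<Rightarrow> 'a set set" where
  "forall_exists C = {{a..b} | a b. a \<le> b \<and>
     (\<forall>x. a \<le> x \<and> x < b \<longrightarrow> (\<exists>y. x < y \<and> y \<le> b \<and> {x..y} \<in> C))}"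

section \<open>Transfinite recursion\<close>

text \<open>An ordinal is represented by an element \<open>i\<close> of the field of an arbitrary well-order \<open>r\<close>
  on an arbitrary type: it stands for the order type of the set \<open>underS r i\<close> of its strict
  predecessors. Every well-order \<open>s\<close> arises in this way, up to isomorphism, by adding a
  top element to \<open>s\<close>.\<close>

definition is_zero :: "'o rel \<Rightarrow> 'o \<Rightarrow> bool" where
  "is_zero r i \<longleftrightarrow> i \<in> Field r \<and> underS r i = {}"

definition is_succ_of :: "'o rel \<Rightarrow> 'o \<Rightarrow> 'o \<Rightarrow> bool" where
  "is_succ_of r i j \<longleftrightarrow> i \<in> Field r \<and> j \<in> Field r \<and> underS r i = insert j (underS r j)"

definition is_limit :: "'o rel \<Rightarrow> 'o \<Rightarrow> bool" where
  "is_limit r i \<longleftrightarrow> i \<in> Field r \<and> \<not> is_zero r i \<and> (\<nexists>j. is_succ_of r i j)"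

text \<open>\<open>transrec r z s l\<close> is the function with value \<open>z\<close> at zero, \<open>s (f j)\<close> at the successor
  of \<open>j\<close>, and \<open>l\<close> applied to the set of all earlier values at limits.\<close>

definition transrec ::
  "'o rel \<Rightarrow> 'b \<Rightarrow> ('b \<Rightarrow> 'b) \<Rightarrow> ('b set \<Rightarrow> 'b) \<Rightarrow> 'o \<Rightarrow> 'b" where
  "transrec r z s l = wo_rel.worec r (\<lambda>f i.
     if is_zero r i then z
     else if \<exists>j. is_succ_of r i j then s (f (THE j. is_succ_of r i j))
     else l (f ` underS r i))"

lemma is_succ_of_unique:
  assumes "Well_order r" "is_succ_of r i j" "is_succ_of r i k"
  shows "j = k"
proof (rule ccontr)
  assume "j \<noteq> k"
  have "insert j (underS r j) = insert k (underS r k)"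
    using assms(2,3) by (simp add: is_succ_of_def)
  then have "j \<in> underS r k" "k \<in> underS r j"
    using \<open>j \<noteq> k\<close> by auto
  moreover have "antisym r"
    using assms(1) by (simp add: order_on_defs)
  ultimately show False
    using \<open>j \<noteq> k\<close> by (auto simp: underS_def dest: antisymD)
qed

lemma transrec_unfold:
  assumes "Well_order r"
  shows "transrec r z s l i =
    (if is_zero r i then z
     else if \<exists>j. is_succ_of r i j then s (transrec r z s l (THE j. is_succ_of r i j))
     else l (transrec r z s l ` underS r i))"
proof -
  let ?H = "\<lambda>f i. if is_zero r i then z
     else if \<exists>j. is_succ_of r i j then s (f (THE j. is_succ_of r i j))
     else l (f ` underS r i)"
  have wo: "wo_rel r"
    using assms by (simp add: wo_rel_def)
  have the: "(THE j. is_succ_of r i j) \<in> underS r i" if "is_succ_of r i j" for i j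
  proof -
    have "(THE j. is_succ_of r i j) = j"
      by (rule the_equality[where P = "is_succ_of r i", OF that])
        (rule is_succ_of_unique[OF assms _ that])
    with that show ?thesis
      by (simp add: is_succ_of_def)
  qed
  have "wo_rel.adm_wo r ?H"
    unfolding wo_rel.adm_wo_def[OF wo]
  proof (intro allI impI)
    fix f g :: "'a \<Rightarrow> 'b" and x
    assume eq: "\<forall>y\<in>underS r x. f y = g y"
    then have "f ` underS r x = g ` underS r x"
      by (auto intro: image_cong)
    moreover have "f (THE j. is_succ_of r x j) = g (THE j. is_succ_of r x j)"
      if "\<exists>j. is_succ_of r x j"
      using eq the that by metis
    ultimately show "?H f x = ?H g x"
      by (intro if_cong refl arg_cong[of _ _ s] arg_cong[of _ _ l])
  qed
  from wo_rel.worec_fixpoint[OF wo this] show ?thesis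
    unfolding transrec_def by (rule fun_cong)
qed

lemma transrec_zero:
  "Well_order r \<Longrightarrow> is_zero r i \<Longrightarrow> transrec r z s l i = z"
  by (subst transrec_unfold) auto

lemma transrec_succ:
  assumes "Well_order r" "is_succ_of r i j"
  shows "transrec r z s l i = s (transrec r z s l j)"
proof -
  have "\<not> is_zero r i"
    using assms(2) by (auto simp: is_zero_def is_succ_of_def)
  moreover have "(THE j. is_succ_of r i j) = j"
    by (rule the_equality[where P = "is_succ_of r i", OF assms(2)])
      (rule is_succ_of_unique[OF assms(1) _ assms(2)])
  moreover have "\<exists>j. is_succ_of r i j"
    using assms(2) ..
  ultimately show ?thesis
    by (simp add: transrec_unfold[OF assms(1), of z s l i])
qed

lemma transrec_limit:
  "Well_order r \<Longrightarrow> is_limit r i \<Longrightarrow> transrec r z s l i = l (transrec r z s l ` underS r i)"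
  unfolding is_limit_def by (subst transrec_unfold) auto

section \<open>The two hierarchies\<close>

definition Gab_iter :: "'o rel \<Rightarrow> 'o \<Rightarrow> 'a::idiom set set \<Rightarrow> 'a set set" where
  "Gab_iter r i B = transrec r B Gab (\<lambda>F. Dvs (\<Union>F)) i"

definition relatively_simple :: "'a::idiom set set \<Rightarrow> 'a set set" where
  "relatively_simple L = {{a..b} | a b. a \<le> b \<and>
     (\<forall>x. a < x \<and> x \<le> b \<longrightarrow> {a..x} \<notin> L \<and> {x..b} \<in> L)}"

text \<open>The simultaneous recursion produces the pair of the \<open>\<L>\<close>- and the \<open>\<D>\<close>-component.\<close>

definition LD :: "'o rel \<Rightarrow> 'o \<Rightarrow> 'a::idiom set set \<times> 'a set set" where
  "LD r = transrec r
     (trivial_intervals, trivial_intervals)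
     (\<lambda>(L, D). let D' = D \<union> relatively_simple L in (L \<union> forall_exists D', D'))
     (\<lambda>P. let D' = \<Union>(snd ` P) in (\<Union>(fst ` P) \<union> forall_exists D', D'))"

definition L_set :: "'o rel \<Rightarrow> 'o \<Rightarrow> 'a::idiom set set" where
  "L_set r i = fst (LD r i)"

definition D_set :: "'o rel \<Rightarrow> 'o \<Rightarrow> 'a::idiom set set" where
  "D_set r i = snd (LD r i)"

definition S_set :: "'o rel \<Rightarrow> 'o \<Rightarrow> 'a::idiom set set" where
  "S_set r i = relatively_simple (L_set r i)"

lemma Gab_iter_zero:
  "Well_order r \<Longrightarrow> is_zero r i \<Longrightarrow> Gab_iter r i B = B"
  by (simp add: Gab_iter_def transrec_zero)

lemma Gab_iter_succ:
  "Well_order r \<Longrightarrow> is_succ_of r i j \<Longrightarrow> Gab_iter r i B = Gab (Gab_iter r j B)"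
  by (simp add: Gab_iter_def transrec_succ)

lemma Gab_iter_limit:
  "Well_order r \<Longrightarrow> is_limit r i \<Longrightarrow> Gab_iter r i B = Dvs (\<Union>j\<in>underS r i. Gab_iter r j B)"
  by (simp add: Gab_iter_def transrec_limit)

lemma LD_zero:
  assumes "Well_order r" "is_zero r i"
  shows "L_set r i = trivial_intervals" "D_set r i = trivial_intervals"
  using assms by (simp_all add: L_set_def D_set_def LD_def transrec_zero)

lemma LD_succ:
  assumes "Well_order r" "is_succ_of r i j"
  shows "D_set r i = D_set r j \<union> S_set r j"
    and "L_set r i = L_set r j \<union> forall_exists (D_set r i)"
  using assms
  by (simp_all add: L_set_def D_set_def S_set_def LD_def transrec_succ Let_def case_prod_beta)

lemma LD_limit:
  assumes "Well_order r" "is_limit r i"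
  shows "D_set r i = (\<Union>j\<in>underS r i. D_set r j)"
    and "L_set r i = (\<Union>j\<in>underS r i. L_set r j) \<union> forall_exists (D_set r i)"
  using assms
  by (simp_all add: L_set_def D_set_def LD_def transrec_limit Let_def image_image)

end

theory Submission
  imports Defs
begin

text \<open>For a basic set \<open>B\<close> the least division set above \<open>B\<close> is \<open>(\<forall>\<exists>)(B)\<close>; upper continuity
  enters only here. Hence \<open>Gab L = (\<forall>\<exists>)(Crt L)\<close>. By transfinite induction
  \<open>\<D>(\<alpha>) \<subseteq> \<L>(\<alpha>) = (\<forall>\<exists>)(\<D>(\<alpha>))\<close>. For the successor step take \<open>[x, y] \<in> Crt(\<L>(\<alpha>))\<close>: either no
  nontrivial \<open>[x, z]\<close> with \<open>z \<le> y\<close> lies in \<open>\<L>(\<alpha>)\<close>, so that \<open>[x, y] \<in> \<S>[\<alpha>]\<close>, or one does and then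
  contains some nontrivial \<open>[x, w] \<in> \<D>(\<alpha>)\<close>. Hence \<open>Crt(\<L>(\<alpha>))\<close> and \<open>\<D>(\<alpha>) \<union> \<S>[\<alpha>]\<close> have the
  same image under \<open>(\<forall>\<exists>)\<close>.\<close>

section \<open>Basic sets of intervals\<close>

text \<open>\<open>similar\<close> allows either interval to be the upper one, so closure under it
  amounts to the single equivalence assumed here.\<close>

lemma basic_setI:
  assumes "C \<subseteq> intervals" "C \<noteq> {}"
    and "\<And>l r. {l..sup l r} \<in> C \<longleftrightarrow> {inf l r..r} \<in> C"
    and "\<And>a b a' b'. a' \<le> a \<Longrightarrow> a \<le> b \<Longrightarrow> b \<le> b' \<Longrightarrow> {a'..b'} \<in> C \<Longrightarrow> {a..b} \<in> C"
  shows "basic_set C"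
  unfolding basic_set_def abstract_set_def
proof (intro conjI ballI allI impI)
  show "J \<in> C" if "I \<in> C" "similar J I" for I J
    using that assms(3) unfolding similar_def by auto
  show "J \<in> C" if "I \<in> C" "subinterval J I" for I J
    using that assms(4) unfolding subinterval_def by blast
qed (use assms in auto)

lemma basic_set_similar:
  "basic_set B \<Longrightarrow> {l..sup l r} \<in> B \<longleftrightarrow> {inf l r..r} \<in> B"
  unfolding basic_set_def abstract_set_def similar_def by blast

lemma basic_set_subinterval:
  "basic_set B \<Longrightarrow> {a'..b'} \<in> B \<Longrightarrow> a' \<le> a \<Longrightarrow> a \<le> b \<Longrightarrow> b \<le> b' \<Longrightarrow> {a..b} \<in> B"
  unfolding basic_set_def subinterval_def by blast

lemma basic_set_intervals: "basic_set B \<Longrightarrow> B \<subseteq> intervals"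
  by (simp add: basic_set_def abstract_set_def)

lemma basic_set_Union:
  assumes "F \<noteq> {}" "\<And>B. B \<in> F \<Longrightarrow> basic_set B"
  shows "basic_set (\<Union>F)"
proof (rule basic_setI)
  show "\<Union>F \<subseteq> intervals"
    using assms(2) basic_set_intervals by blast
  show "\<Union>F \<noteq> {}"
    using assms unfolding basic_set_def abstract_set_def by blast
  show "{l..sup l r} \<in> \<Union>F \<longleftrightarrow> {inf l r..r} \<in> \<Union>F" for l r
    using basic_set_similar[OF assms(2), of _ l r] by blast
  show "{a..b} \<in> \<Union>F" if "a' \<le> a" "a \<le> b" "b \<le> b'" "{a'..b'} \<in> \<Union>F" for a b a' b'
    using basic_set_subinterval[OF assms(2), of _ a' b' a b] that by blast
qed

section \<open>Membership of an interval in the operators, read off its endpoints\<close>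

lemma Crt_iff:
  "{a..b} \<in> Crt B \<longleftrightarrow> a \<le> b \<and> (\<forall>x. a < x \<and> x \<le> b \<longrightarrow> {x..b} \<in> B)"
  unfolding Crt_def by (auto simp: Icc_eq_Icc order_le_less)

lemma relatively_simple_iff:
  "{a..b} \<in> relatively_simple L \<longleftrightarrow>
    a \<le> b \<and> (\<forall>x. a < x \<and> x \<le> b \<longrightarrow> {a..x} \<notin> L \<and> {x..b} \<in> L)"
  unfolding relatively_simple_def by (auto simp: Icc_eq_Icc)

lemma forall_exists_iff:
  "{a..b} \<in> forall_exists C \<longleftrightarrow>
    a \<le> b \<and> (\<forall>x. a \<le> x \<and> x < b \<longrightarrow> (\<exists>y. x < y \<and> y \<le> b \<and> {x..y} \<in> C))"
  unfolding forall_exists_def by (auto simp: Icc_eq_Icc)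

lemma Crt_intervals: "Crt B \<subseteq> intervals"
  unfolding Crt_def intervals_def by blast

lemma forall_exists_intervals: "forall_exists C \<subseteq> intervals"
  unfolding forall_exists_def intervals_def by blast

text \<open>This and the next lemma form the diamond isomorphism: \<open>x \<mapsto> sup l x\<close>
  from \<open>[inf l r, r]\<close> to \<open>[l, sup l r]\<close> and
  \<open>x \<mapsto> inf x r\<close> back are mutually inverse. They carry conditions across similar
  intervals.\<close>

lemma modular_inf_sup:
  fixes l r x :: "'a::idiom"
  assumes "inf l r \<le> x" "x \<le> r"
  shows "inf (sup l x) r = x"
  using modular[OF assms(2), of l] assms(1) by (simp add: sup.commute sup_absorb1)

lemma modular_sup_inf:
  fixes l r x :: "'a::idiom"
  assumes "l \<le> x" "x \<le> sup l r"
  shows "sup l (inf x r) = x"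
  using modular[OF assms(1), of r] assms(2) by (simp add: inf.commute inf_absorb1)

text \<open>The diamond isomorphism matches upper parts with upper parts: for \<open>x\<close> in
  the lower interval \<open>[x, r]\<close> is similar to \<open>[sup l x, sup l r]\<close>, and for
  \<open>x\<close> in the upper one \<open>[x, sup l r]\<close> is similar to
  \<open>[inf x r, r]\<close>.\<close>

lemma basic_set_Crt:
  fixes B :: "'a::idiom set set"
  assumes B: "basic_set B"
  shows "basic_set (Crt B)"
proof (rule basic_setI[OF Crt_intervals])
  have "{bot..bot} \<in> Crt B"
    unfolding Crt_iff by auto
  then show "Crt B \<noteq> {}" by blast
next
  fix l r :: 'a
  show "{l..sup l r} \<in> Crt B \<longleftrightarrow> {inf l r..r} \<in> Crt B"
  proof
    assume L: "{l..sup l r} \<in> Crt B"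
    have "{x..r} \<in> B" if x: "inf l r < x" "x \<le> r" for x
    proof -
      have meet: "inf (sup l x) r = x"
        using x by (intro modular_inf_sup) auto
      then have "l \<noteq> sup l x"
        using x by auto
      then have "l < sup l x"
        by (simp add: less_le)
      moreover have "sup l x \<le> sup l r"
        using x by (simp add: le_supI2)
      ultimately have "{sup l x..sup l r} \<in> B"
        using L by (simp add: Crt_iff)
      moreover have "sup (sup l x) r = sup l r"
        using x by (simp add: sup.assoc sup_absorb2)
      ultimately show ?thesis
        using basic_set_similar[OF B, of "sup l x" r] meet by simp
    qed
    then show "{inf l r..r} \<in> Crt B"
      by (simp add: Crt_iff)
  next
    assume R: "{inf l r..r} \<in> Crt B"
    have "{x..sup l r} \<in> B" if x: "l < x" "x \<le> sup l r" for x
    proof -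
      have join: "sup l (inf x r) = x"
        using x by (intro modular_sup_inf) auto
      then have "inf l r \<noteq> inf x r"
        using x by (metis less_irrefl sup_inf_absorb)
      moreover have "inf l r \<le> inf x r"
        using x by (simp add: le_infI1)
      ultimately have "{inf x r..r} \<in> B"
        using R by (simp add: Crt_iff less_le)
      moreover have "sup x r = sup l r"
        using x by (intro antisym) (simp_all add: le_supI1)
      ultimately show ?thesis
        using basic_set_similar[OF B, of x r] by simp
    qed
    then show "{l..sup l r} \<in> Crt B"
      by (simp add: Crt_iff)
  qed
next
  fix a b a' b' :: 'a
  assume *: "a' \<le> a" "a \<le> b" "b \<le> b'" "{a'..b'} \<in> Crt B"
  have "{x..b} \<in> B" if "a < x" "x \<le> b" for x
  proof -
    have "a' < x" "x \<le> b'"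
      using * that by (auto intro: le_less_trans order_trans)
    then have "{x..b'} \<in> B"
      using * by (simp add: Crt_iff)
    then show ?thesis
      using basic_set_subinterval[OF B] * that by blast
  qed
  then show "{a..b} \<in> Crt B"
    using * by (simp add: Crt_iff)
qed

lemma subset_Crt:
  fixes B :: "'a::idiom set set"
  assumes B: "basic_set B"
  shows "B \<subseteq> Crt B"
proof
  fix I assume I: "I \<in> B"
  then obtain a b where [simp]: "I = {a..b}" and "a \<le> b"
    using basic_set_intervals[OF B] unfolding intervals_def by blast
  have "{x..b} \<in> B" if "a < x" "x \<le> b" for x
    using basic_set_subinterval[OF B, of a b x b] I that by simp
  then show "I \<in> Crt B"
    using \<open>a \<le> b\<close> by (simp add: Crt_iff)
qed

section \<open>The generated division set\<close>

lemma forall_exists_mono: "C \<subseteq> D \<Longrightarrow> forall_exists C \<subseteq> forall_exists D"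
  unfolding forall_exists_def by blast

lemma subset_forall_exists:
  fixes B :: "'a::idiom set set"
  assumes B: "basic_set B"
  shows "B \<subseteq> forall_exists B"
proof
  fix I assume I: "I \<in> B"
  then obtain a b where [simp]: "I = {a..b}" and "a \<le> b"
    using basic_set_intervals[OF B] unfolding intervals_def by blast
  have "{x..b} \<in> B" if "a \<le> x" "x < b" for x
    using basic_set_subinterval[OF B, of a b x b] I that by simp
  then show "I \<in> forall_exists B"
    using \<open>a \<le> b\<close> by (auto simp: forall_exists_iff)
qed

text \<open>Transports the defining property of \<open>[a, b]\<close> to any \<open>z\<close> above
  \<open>a\<close> that does not contain \<open>b\<close>, even if \<open>z\<close> is not below
  \<open>b\<close>: take a witness above \<open>inf z b\<close> and join it with \<open>z\<close>.
  Similarity, concatenation and suprema all rest on this.\<close>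

lemma forall_exists_above:
  fixes B :: "'a::idiom set set"
  assumes B: "basic_set B" and ab: "{a..b} \<in> forall_exists B" and z: "a \<le> z" "\<not> b \<le> z"
  shows "\<exists>y\<le>b. z < sup z y \<and> {z..sup z y} \<in> B"
proof -
  have "a \<le> b"
    using ab by (simp add: forall_exists_iff)
  have "inf z b \<noteq> b"
    using z(2) by (metis inf_le1)
  then have "inf z b < b"
    by (simp add: less_le)
  moreover have "a \<le> inf z b"
    using z \<open>a \<le> b\<close> by simp
  ultimately obtain y where y: "inf z b < y" "y \<le> b" "{inf z b..y} \<in> B"
    using ab unfolding forall_exists_iff by blast
  \<comment> \<open>Since \<open>inf z b < y \<le> b\<close>, both meets agree, so
    \<open>[inf z b, y]\<close> is the lower interval similar to
    \<open>[z, sup z y]\<close>.\<close>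
  have "inf z y = inf z b"
    using y by (intro antisym) (simp_all add: le_infI2)
  then have "{z..sup z y} \<in> B"
    using y basic_set_similar[OF B, of z y] by simp
  moreover have "\<not> y \<le> z"
    using y(1) \<open>inf z y = inf z b\<close> by (auto simp: inf_absorb2)
  then have "z < sup z y"
    by (simp add: less_le_not_le)
  ultimately show ?thesis
    using y by blast
qed

text \<open>A relative pseudocomplement of \<open>c\<close> over \<open>x\<close> within
  \<open>[x, b]\<close>, obtained from Zorn's lemma; upper continuity keeps the condition on the
  meet valid at suprema of chains.\<close>

lemma exists_maximal_meet:
  fixes b c x :: "'a::idiom"
  assumes "x \<le> c" "c \<le> b"
  shows "\<exists>z. x \<le> z \<and> z \<le> b \<and> inf z c = x \<and>
    (\<forall>w. z \<le> w \<and> w \<le> b \<and> inf w c = x \<longrightarrow> w = z)"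
proof -
  \<comment> \<open>The bound \<open>x \<le> z\<close> is left out of \<open>A\<close> because it
    follows from \<open>inf z c = x\<close>.\<close>
  define A where "A = {z. z \<le> b \<and> inf z c = x}"
  have "x \<in> A"
    using assms by (auto simp: A_def inf_absorb1)
  have "\<exists>m\<in>A. \<forall>w\<in>A. m \<le> w \<longrightarrow> w = m"
  proof (rule predicate_Zorn)
    show "partial_order_on A (relation_of (\<le>) A)"
      by (rule partial_order_on_relation_ofI) auto
    fix C assume "C \<in> Chains (relation_of (\<le>) A)"
    then have CA: "C \<subseteq> A" and lin: "\<And>u v. u \<in> C \<Longrightarrow> v \<in> C \<Longrightarrow> u \<le> v \<or> v \<le> u"
      unfolding Chains_def relation_of_def by blast+
    show "\<exists>u\<in>A. \<forall>w\<in>C. w \<le> u"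
    proof (cases "C = {}")
      case True
      then show ?thesis using \<open>x \<in> A\<close> by blast
    next
      case False
      \<comment> \<open>A nonempty chain is directed; every meet in the image equals
        \<open>x\<close>, so the supremum on the right is \<open>x\<close>.\<close>
      have "inf c (Sup C) = Sup (inf c ` C)"
        by (rule upper_continuous[OF False]) (use lin in blast)
      also have "inf c ` C = {x}"
        using False CA by (auto simp: A_def inf.commute)
      finally have "inf (Sup C) c = x"
        by (simp add: inf.commute)
      moreover have "Sup C \<le> b"
        using CA by (intro Sup_least) (auto simp: A_def)
      ultimately show ?thesis
        by (auto simp: A_def intro!: bexI[of _ "Sup C"] Sup_upper)
    qed
  qed
  then obtain m where "m \<in> A" and max: "\<forall>w\<in>A. m \<le> w \<longrightarrow> w = m"
    by blast
  moreover from \<open>m \<in> A\<close> have "x \<le> m"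
    unfolding A_def using inf_le1 by blast
  ultimately show ?thesis
    unfolding A_def by blast
qed

text \<open>Lowering along a similarity uses the diamond isomorphism, raising uses
  \<open>forall_exists_above\<close>. The delicate point is the subinterval property, where a
  witness found below \<open>b'\<close> must leave a nontrivial trace below
  \<open>b\<close>.\<close>

lemma basic_set_forall_exists:
  fixes B :: "'a::idiom set set"
  assumes B: "basic_set B"
  shows "basic_set (forall_exists B)"
proof (rule basic_setI[OF forall_exists_intervals])
  have "{bot..bot} \<in> forall_exists B"
    unfolding forall_exists_iff by auto
  then show "forall_exists B \<noteq> {}" by blast
next
  fix l r :: 'a
  show "{l..sup l r} \<in> forall_exists B \<longleftrightarrow> {inf l r..r} \<in> forall_exists B"
  proof
    assume L: "{l..sup l r} \<in> forall_exists B"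
    have "\<exists>y. x < y \<and> y \<le> r \<and> {x..y} \<in> B" if x: "inf l r \<le> x" "x < r" for x
    proof -
      have meet: "inf (sup l x) r = x"
        using x by (intro modular_inf_sup) auto
      have "sup l x \<noteq> sup l r"
        using meet x by (auto simp: inf_absorb2)
      moreover have "sup l x \<le> sup l r"
        using x by (simp add: le_supI2)
      ultimately have "sup l x < sup l r"
        by (simp add: less_le)
      moreover have "l \<le> sup l x"
        by simp
      ultimately obtain y where y: "sup l x < y" "y \<le> sup l r" "{sup l x..y} \<in> B"
        using L unfolding forall_exists_iff by blast
      have "sup (sup l x) r = sup l r"
        using x by (simp add: sup.assoc sup_absorb2)
      \<comment> \<open>The witness \<open>y\<close> lies in
        \<open>[sup l x, sup (sup l x) r]\<close>, so the isomorphism with base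
        \<open>sup l x\<close> recovers it from its trace \<open>inf y r\<close>.\<close>
      then have join: "sup (sup l x) (inf y r) = y"
        using y(1,2) less_imp_le[OF y(1)] by (intro modular_sup_inf) simp_all
      have xy: "inf (sup l x) (inf y r) = x"
        using meet by (simp add: inf.assoc[symmetric] inf_absorb1[OF less_imp_le[OF y(1)]])
      then have "{x..inf y r} \<in> B"
        using y join basic_set_similar[OF B, of "sup l x" "inf y r"] by simp
      moreover have "x \<le> inf y r"
        using xy inf_le2 by metis
      \<comment> \<open>If they were equal, \<open>join\<close> would collapse \<open>y\<close> to
        \<open>sup l x\<close>.\<close>
      moreover have "x \<noteq> inf y r"
        using join y(1) by (auto simp: sup.assoc)
      ultimately show ?thesis
        by (intro exI[of _ "inf y r"]) (simp add: less_le)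
    qed
    moreover have "inf l r \<le> r"
      by simp
    ultimately show "{inf l r..r} \<in> forall_exists B"
      unfolding forall_exists_iff by blast
  next
    assume R: "{inf l r..r} \<in> forall_exists B"
    have "\<exists>y. x < y \<and> y \<le> sup l r \<and> {x..y} \<in> B" if x: "l \<le> x" "x < sup l r" for x
    proof -
      have "\<not> r \<le> x"
        using x le_supI leD by blast
      moreover have "inf l r \<le> x"
        using x by (simp add: le_infI1)
      ultimately obtain y where "y \<le> r" "x < sup x y" "{x..sup x y} \<in> B"
        using forall_exists_above[OF B R] by blast
      moreover have "sup x y \<le> sup l r"
        using x \<open>y \<le> r\<close> by (simp add: le_supI2)
      ultimately show ?thesis by blast
    qed
    moreover have "l \<le> sup l r"
      by simp
    ultimately show "{l..sup l r} \<in> forall_exists B"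
      unfolding forall_exists_iff by blast
  qed
next
  fix a b a' b' :: 'a
  assume *: "a' \<le> a" "a \<le> b" "b \<le> b'" "{a'..b'} \<in> forall_exists B"
  have "\<exists>y. x < y \<and> y \<le> b \<and> {x..y} \<in> B" if x: "a \<le> x" "x < b" for x
  proof -
    \<comment> \<open>A witness above \<open>x\<close> itself could meet \<open>b\<close> only in
      \<open>x\<close>. Starting from a maximal \<open>z\<close> with \<open>inf z b = x\<close>
      excludes this: every larger \<open>y \<le> b'\<close> meets \<open>b\<close> strictly above
      \<open>x\<close>.\<close>
    obtain z where z: "x \<le> z" "z \<le> b'" "inf z b = x"
      and max: "\<And>w. z \<le> w \<Longrightarrow> w \<le> b' \<Longrightarrow> inf w b = x \<Longrightarrow> w = z"
      using exists_maximal_meet[OF less_imp_le[OF x(2)] *(3)] by blast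
    have "z \<noteq> b'"
      using z(3) x *(3) by (auto simp: inf_absorb2)
    then have "z < b'"
      using z by (simp add: less_le)
    moreover have "a' \<le> z"
      using *(1) x(1) z(1) by (blast intro: order_trans)
    ultimately obtain y where y: "z < y" "y \<le> b'" "{z..y} \<in> B"
      using *(4) unfolding forall_exists_iff by blast
    have "inf y b \<noteq> x"
      using max[OF less_imp_le[OF y(1)] y(2)] y(1) by blast
    moreover have "x \<le> inf y b"
      using x y z by (simp add: order.trans[OF z(1)])
    moreover have "{x..inf y b} \<in> B"
    proof -
      \<comment> \<open>This is an initial part of \<open>[z, y]\<close>, and it is similar to
        \<open>[x, inf y b]\<close> because \<open>inf z (inf y b) = inf z b = x\<close>.\<close>
      have "{z..sup z (inf y b)} \<in> B"
        using y by (intro basic_set_subinterval[OF B y(3)]) (simp_all add: le_infI1)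
      moreover have "inf z (inf y b) = x"
        using y z by (simp add: inf.assoc[symmetric] inf_absorb1)
      ultimately show ?thesis
        using basic_set_similar[OF B, of z "inf y b"] by simp
    qed
    ultimately show ?thesis
      by (intro exI[of _ "inf y b"]) (simp add: less_le)
  qed
  then show "{a..b} \<in> forall_exists B"
    using *(2) unfolding forall_exists_iff by blast
qed

text \<open>In both closure conditions, a point that is not yet the top fails to contain the right
  end of some given interval, and \<open>forall_exists_above\<close> supplies a step from that
  point.\<close>

lemma division_set_forall_exists:
  fixes B :: "'a::idiom set set"
  assumes B: "basic_set B"
  shows "division_set (forall_exists B)"
  unfolding division_set_def congruence_set_def pre_division_set_def
proof (intro conjI allI impI basic_set_forall_exists[OF B])
  fix a b c :: 'a
  assume *: "a \<le> b \<and> b \<le> c \<and> {a..b} \<in> forall_exists B \<and> {b..c} \<in> forall_exists B"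
  have "\<exists>y. x < y \<and> y \<le> c \<and> {x..y} \<in> B" if x: "a \<le> x" "x < c" for x
  \<comment> \<open>If \<open>b \<le> x\<close>, the interval \<open>[b, c]\<close> gives the
    witness directly; otherwise a step is lifted from \<open>[a, b]\<close>.\<close>
  proof (cases "b \<le> x")
    case True
    then show ?thesis
      using * x by (simp add: forall_exists_iff)
  next
    case False
    then obtain y where "y \<le> b" "x < sup x y" "{x..sup x y} \<in> B"
      using forall_exists_above[OF B, of a b x] * x by blast
    then show ?thesis
      using * x by (intro exI[of _ "sup x y"]) auto
  qed
  moreover have "a \<le> c"
    using * by (blast intro: order_trans)
  ultimately show "{a..c} \<in> forall_exists B"
    unfolding forall_exists_iff by blast
next
  fix a :: 'a and X
  assume *: "X \<subseteq> {a..} \<and> (\<forall>x\<in>X. {a..x} \<in> forall_exists B)"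
  have "\<exists>y. z < y \<and> y \<le> sup a (Sup X) \<and> {z..y} \<in> B" if z: "a \<le> z" "z < sup a (Sup X)" for z
  proof -
    have "\<not> Sup X \<le> z"
      using z le_supI leD by blast
    then obtain x where "x \<in> X" "\<not> x \<le> z"
      using Sup_least by blast
    then obtain y where "y \<le> x" "z < sup z y" "{z..sup z y} \<in> B"
      using forall_exists_above[OF B, of a x z] * z by blast
    moreover have "y \<le> Sup X"
      using \<open>y \<le> x\<close> \<open>x \<in> X\<close> by (rule Sup_upper2[rotated])
    then have "sup z y \<le> sup a (Sup X)"
      using z by (simp add: le_supI2)
    ultimately show ?thesis by blast
  qed
  moreover have "a \<le> sup a (Sup X)"
    by simp
  ultimately show "{a..sup a (Sup X)} \<in> forall_exists B"
    unfolding forall_exists_iff by blast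
qed

text \<open>Climb from \<open>a\<close> inside \<open>D\<close>: the pre-division property reaches
  the supremum of all points attainable below \<open>b\<close>, and if this were still below
  \<open>b\<close>, a step in \<open>B\<close> and the congruence property would go beyond
  it.\<close>

lemma forall_exists_subset_division_set:
  fixes B :: "'a::idiom set set"
  assumes D: "division_set D" and "B \<subseteq> D"
  shows "forall_exists B \<subseteq> D"
proof
  fix I assume "I \<in> forall_exists B"
  then obtain a b where [simp]: "I = {a..b}" and "a \<le> b" and ab: "{a..b} \<in> forall_exists B"
    unfolding forall_exists_def by blast
  define X where "X = {x. a \<le> x \<and> x \<le> b \<and> {a..x} \<in> D}"
  define s where "s = sup a (Sup X)"
  have "X \<subseteq> {a..} \<and> (\<forall>x\<in>X. {a..x} \<in> D)"
    by (auto simp: X_def)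
  then have s: "{a..s} \<in> D"
    using D unfolding division_set_def pre_division_set_def s_def by blast
  have "a \<le> s" "s \<le> b"
    using \<open>a \<le> b\<close> by (auto simp: s_def X_def intro: Sup_least)
  have "s = b"
  proof (rule ccontr)
    assume "s \<noteq> b"
    then have "s < b"
      using \<open>s \<le> b\<close> by (simp add: less_le)
    then obtain y where y: "s < y" "y \<le> b" "{s..y} \<in> B"
      using ab \<open>a \<le> s\<close> unfolding forall_exists_iff by blast
    then have "{s..y} \<in> D"
      using \<open>B \<subseteq> D\<close> by blast
    then have "{a..y} \<in> D"
      using D s \<open>a \<le> s\<close> less_imp_le[OF y(1)]
      unfolding division_set_def congruence_set_def by blast
    then have "y \<in> X"
      using y \<open>a \<le> s\<close> by (simp add: X_def)
    then have "y \<le> s"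
      by (simp add: s_def le_supI2 Sup_upper)
    then show False
      using y by simp
  qed
  then show "I \<in> D"
    using s by simp
qed

lemma Dvs_eq_forall_exists:
  fixes B :: "'a::idiom set set"
  assumes B: "basic_set B"
  shows "Dvs B = forall_exists B"
  unfolding Dvs_def
proof (rule Least_equality)
  show "division_set (forall_exists B) \<and> B \<subseteq> forall_exists B"
    using division_set_forall_exists[OF B] subset_forall_exists[OF B] ..
qed (simp add: forall_exists_subset_division_set)

lemma Gab_eq_forall_exists:
  "basic_set B \<Longrightarrow> Gab B = forall_exists (Crt B)"
  by (simp add: Gab_def Dvs_eq_forall_exists basic_set_Crt)

section \<open>Comparison of the hierarchies\<close>

lemma forall_exists_refine:
  "x < y \<Longrightarrow> {x..y} \<in> forall_exists C \<Longrightarrow> \<exists>w. x < w \<and> w \<le> y \<and> {x..w} \<in> C"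
  by (simp add: forall_exists_iff)

text \<open>Only nontrivial initial pieces matter to \<open>forall_exists\<close>: a witness from
  \<open>E\<close> can be shortened to one from \<open>C\<close> with the same left end.\<close>

lemma forall_exists_eqI:
  fixes C E :: "'a::idiom set set"
  assumes "C \<subseteq> E"
    and refine: "\<And>x y. x < y \<Longrightarrow> {x..y} \<in> E \<Longrightarrow> \<exists>w. x < w \<and> w \<le> y \<and> {x..w} \<in> C"
  shows "forall_exists C = forall_exists E"
proof
  show "forall_exists C \<subseteq> forall_exists E"
    using assms(1) by (rule forall_exists_mono)
  show "forall_exists E \<subseteq> forall_exists C"
  proof
    fix I assume "I \<in> forall_exists E"
    then obtain a b where [simp]: "I = {a..b}" and ab: "{a..b} \<in> forall_exists E"
      unfolding forall_exists_def by blast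
    have "\<exists>w. x < w \<and> w \<le> b \<and> {x..w} \<in> C" if x: "a \<le> x" "x < b" for x
    proof -
      obtain y where "x < y" "y \<le> b" "{x..y} \<in> E"
        using ab x unfolding forall_exists_iff by blast
      moreover from this obtain w where "x < w" "w \<le> y" "{x..w} \<in> C"
        using refine by blast
      ultimately show ?thesis
        by (blast intro: order_trans)
    qed
    then show "I \<in> forall_exists C"
      using ab by (simp add: forall_exists_iff)
  qed
qed

lemma relatively_simple_subset_Crt: "relatively_simple L \<subseteq> Crt L"
proof
  fix I assume "I \<in> relatively_simple L"
  then obtain a b where "I = {a..b}" "{a..b} \<in> relatively_simple L"
    unfolding relatively_simple_def by blast
  then show "I \<in> Crt L"
    by (simp add: relatively_simple_iff Crt_iff)
qed

lemma forall_exists_Un_relatively_simple: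
  fixes L D :: "'a::idiom set set"
  assumes L: "basic_set L" and LD: "L = forall_exists D" and "D \<subseteq> L"
  shows "forall_exists (D \<union> relatively_simple L) = forall_exists (Crt L)"
proof (rule forall_exists_eqI)
  show "D \<union> relatively_simple L \<subseteq> Crt L"
    using \<open>D \<subseteq> L\<close> subset_Crt[OF L] relatively_simple_subset_Crt by blast
  fix x y :: 'a
  assume xy: "x < y" "{x..y} \<in> Crt L"
  show "\<exists>w. x < w \<and> w \<le> y \<and> {x..w} \<in> D \<union> relatively_simple L"
  proof (cases "\<exists>z. x < z \<and> z \<le> y \<and> {x..z} \<in> L")
    case True
    then obtain z where z: "x < z" "z \<le> y" "{x..z} \<in> forall_exists D"
      using LD by blast
    then obtain w where "x < w" "w \<le> z" "{x..w} \<in> D"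
      using forall_exists_refine by blast
    then show ?thesis
      using z(2) by (blast intro: order_trans)
  next
    case False
    \<comment> \<open>The failed case gives the negative half of relative simplicity, and membership
      in \<open>Crt L\<close> gives the positive half.\<close>
    then have "{x..y} \<in> relatively_simple L"
      using xy unfolding relatively_simple_iff Crt_iff by blast
    then show ?thesis
      using xy by blast
  qed
qed

section \<open>Stage zero: the trivial intervals\<close>

lemma trivial_intervals_iff:
  "a \<le> b \<Longrightarrow> {a..b} \<in> trivial_intervals \<longleftrightarrow> a = b"
  by (auto simp: trivial_intervals_def Icc_eq_Icc)

lemma forall_exists_trivial_intervals:
  "forall_exists trivial_intervals = (trivial_intervals :: 'a::idiom set set)"
proof
  show "forall_exists trivial_intervals \<subseteq> (trivial_intervals :: 'a set set)"
  proof
    fix I :: "'a set" assume "I \<in> forall_exists trivial_intervals"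
    then obtain a b where [simp]: "I = {a..b}" and "a \<le> b"
      and ab: "{a..b} \<in> forall_exists trivial_intervals"
      unfolding forall_exists_def by blast
    have "\<not> a < b"
    proof
      assume "a < b"
      then obtain w where "a < w" "{a..w} \<in> trivial_intervals"
        using forall_exists_refine[OF _ ab] by blast
      then show False
        by (simp add: trivial_intervals_iff)
    qed
    then have "a = b"
      using \<open>a \<le> b\<close> by (simp add: less_le)
    then show "I \<in> trivial_intervals"
      by (simp only: \<open>I = {a..b}\<close> trivial_intervals_iff[OF order_refl])
  qed
  show "trivial_intervals \<subseteq> forall_exists (trivial_intervals :: 'a set set)"
  proof
    fix I :: "'a set" assume "I \<in> trivial_intervals"
    then obtain a where "I = {a..a}"
      unfolding trivial_intervals_def by blast
    then show "I \<in> forall_exists trivial_intervals"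
      by (auto simp only: forall_exists_iff)
  qed
qed

lemma basic_set_trivial_intervals:
  "basic_set (trivial_intervals :: 'a::idiom set set)"
proof (rule basic_setI)
  show "trivial_intervals \<subseteq> (intervals :: 'a set set)"
    unfolding trivial_intervals_def intervals_def by blast
  show "trivial_intervals \<noteq> ({} :: 'a set set)"
    unfolding trivial_intervals_def by blast
  show "{l..sup l r} \<in> trivial_intervals \<longleftrightarrow> {inf l r..r} \<in> trivial_intervals" for l r :: 'a
  proof -
    \<comment> \<open>Both equations express \<open>r \<le> l\<close>.\<close>
    have "l = sup l r \<longleftrightarrow> inf l r = r"
      by (metis le_iff_inf le_iff_sup inf.commute sup.commute)
    then show ?thesis
      by (simp add: trivial_intervals_iff)
  qed
  show "{a..b} \<in> trivial_intervals"
    if "a' \<le> a" "a \<le> b" "b \<le> b'" "{a'..b'} \<in> trivial_intervals" for a b a' b' :: 'a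
  proof -
    have "a' \<le> b'"
      using that by (blast intro: order_trans)
    then have "a' = b'"
      using that by (simp add: trivial_intervals_iff)
    then have "b \<le> a"
      using that by (blast intro: order_trans)
    then have "a = b"
      using that by simp
    then show ?thesis
      by (simp only: trivial_intervals_iff[OF order_refl])
  qed
qed

text \<open>The equality is strengthened for the induction: basicness turns \<open>Dvs\<close> and
  \<open>Gab\<close> into \<open>forall_exists\<close> of a known set, while the two relations
  between \<open>L_set\<close> and \<open>D_set\<close> let intervals of the former be refined by
  intervals of the latter.\<close>

lemma hierarchy_invariant:
  fixes r :: "'o rel" and \<alpha> :: 'o
  assumes wo: "Well_order r" and "\<alpha> \<in> Field r"
  shows "L_set r \<alpha> = Gab_iter r \<alpha> (trivial_intervals :: 'a::idiom set set) \<and>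
    basic_set (L_set r \<alpha> :: 'a set set) \<and>
    L_set r \<alpha> = forall_exists (D_set r \<alpha> :: 'a set set) \<and>
    D_set r \<alpha> \<subseteq> (L_set r \<alpha> :: 'a set set)"
    (is "?P \<alpha>")
proof -
  have "\<alpha> \<in> Field r \<longrightarrow> ?P \<alpha>"
  proof (rule wo_rel.well_order_induct[of r "\<lambda>i. i \<in> Field r \<longrightarrow> ?P i"])
    show "wo_rel r"
      using wo by (simp add: wo_rel_def)
    fix i
    assume hyp: "\<forall>j. j \<noteq> i \<and> (j, i) \<in> r \<longrightarrow> j \<in> Field r \<longrightarrow> ?P j"
    show "i \<in> Field r \<longrightarrow> ?P i"
    proof
      assume i: "i \<in> Field r"
      have IH: "?P j" if "j \<in> underS r i" for j
      proof -
        have "j \<noteq> i" "(j, i) \<in> r"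
          using that by (simp_all add: underS_def)
        moreover from this have "j \<in> Field r"
          by (auto simp: Field_def)
        ultimately show ?thesis
          using hyp by blast
      qed
      consider (zero) "is_zero r i" | (succ) j where "is_succ_of r i j" | (limit) "is_limit r i"
        using i unfolding is_limit_def by blast
      then show "?P i"
      proof cases
        case zero
        then show ?thesis
          using wo by (simp add: LD_zero Gab_iter_zero forall_exists_trivial_intervals
              basic_set_trivial_intervals)
      next
        case (succ j)
        define L :: "'a set set" where "L = L_set r j"
        define D :: "'a set set" where "D = D_set r j"
        define D' :: "'a set set" where "D' = D_set r i"
        have "j \<in> underS r i"
          using succ by (auto simp: is_succ_of_def)
        from IH[OF this] have Gab: "L = Gab_iter r j trivial_intervals" and L: "basic_set L"
          and LD: "L = forall_exists D" and "D \<subseteq> L"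
          unfolding L_def D_def by blast+
        have D': "D' = D \<union> relatively_simple L"
          using LD_succ(1)[OF wo succ] by (simp add: S_set_def D'_def D_def L_def)
        \<comment> \<open>Hence the old stage in the union defining \<open>L_set r i\<close> is
          absorbed by \<open>forall_exists D'\<close>.\<close>
        have "L \<subseteq> forall_exists D'"
          unfolding LD D' by (rule forall_exists_mono) simp
        then have Li: "L_set r i = forall_exists D'"
          using LD_succ(2)[OF wo succ] unfolding D'_def L_def by blast
        also have "\<dots> = forall_exists (Crt L)"
          unfolding D' using L LD \<open>D \<subseteq> L\<close> by (rule forall_exists_Un_relatively_simple)
        finally have LC: "L_set r i = forall_exists (Crt L)" .
        have "D' \<subseteq> Crt L"
          using \<open>D \<subseteq> L\<close> subset_Crt[OF L] relatively_simple_subset_Crt unfolding D' by blast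
        then have "D' \<subseteq> L_set r i"
          unfolding LC using subset_forall_exists[OF basic_set_Crt[OF L]] by (rule subset_trans)
        moreover have "L_set r i = Gab_iter r i (trivial_intervals :: 'a set set)"
          using LC by (simp add: Gab_iter_succ[OF wo succ] Gab_eq_forall_exists[OF L] flip: Gab)
        moreover have "basic_set (L_set r i :: 'a set set)"
          unfolding LC using L by (intro basic_set_forall_exists basic_set_Crt)
        ultimately show ?thesis
          using Li unfolding D'_def by simp
      next
        case limit
        define U :: "'a set set" where "U = (\<Union>j\<in>underS r i. L_set r j)"
        define D' :: "'a set set" where "D' = D_set r i"
        have "underS r i \<noteq> {}"
          using limit by (auto simp: is_limit_def is_zero_def)
        then have U: "basic_set U"
          unfolding U_def using IH by (intro basic_set_Union) blast+
        have D': "D' = (\<Union>j\<in>underS r i. D_set r j)"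
          and Li: "L_set r i = U \<union> forall_exists D'"
          using LD_limit[OF wo limit] by (simp_all add: D'_def U_def)
        have LDj: "L_set r j = forall_exists (D_set r j :: 'a set set)" if "j \<in> underS r i" for j
          using IH[OF that] by blast
        have "L_set r j \<subseteq> forall_exists D'" if j: "j \<in> underS r i" for j
        proof -
          have "D_set r j \<subseteq> D'"
            using D' j by blast
          then have "forall_exists (D_set r j) \<subseteq> forall_exists D'"
            by (rule forall_exists_mono)
          then show ?thesis
            by (simp add: LDj[OF j])
        qed
        then have LD': "L_set r i = forall_exists D'"
          using Li unfolding U_def by blast
        have "D' \<subseteq> U"
          using IH unfolding D' U_def by blast
        \<comment> \<open>An interval of \<open>U\<close> already lies in some earlier
          \<open>L_set r j\<close>, so it starts with a piece from \<open>D_set r j\<close>, which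
          is contained in \<open>D'\<close>.\<close>
        then have "forall_exists D' = forall_exists U"
        proof (rule forall_exists_eqI)
          fix x y :: 'a
          assume "x < y" "{x..y} \<in> U"
          then obtain j where j: "j \<in> underS r i" "{x..y} \<in> L_set r j"
            unfolding U_def by blast
          then have "{x..y} \<in> forall_exists (D_set r j)"
            by (simp add: LDj)
          then obtain w where "x < w" "w \<le> y" "{x..w} \<in> D_set r j"
            using forall_exists_refine[OF \<open>x < y\<close>] by blast
          then show "\<exists>w. x < w \<and> w \<le> y \<and> {x..w} \<in> D'"
            using D' j by blast
        qed
        then have LU: "L_set r i = forall_exists U"
          using LD' by simp
        \<comment> \<open>By induction \<open>U\<close> is the union whose \<open>Dvs\<close> is the
          limit stage of \<open>Gab_iter\<close>; as \<open>U\<close> is basic, that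
          \<open>Dvs\<close> is \<open>forall_exists U\<close>.\<close>
        have "U = (\<Union>j\<in>underS r i. Gab_iter r j trivial_intervals)"
          unfolding U_def using IH by simp
        then have "L_set r i = Gab_iter r i (trivial_intervals :: 'a set set)"
          using LU Dvs_eq_forall_exists[OF U] by (simp add: Gab_iter_limit[OF wo limit])
        moreover have "D' \<subseteq> L_set r i"
          using \<open>D' \<subseteq> U\<close> Li by blast
        moreover have "basic_set (L_set r i :: 'a set set)"
          unfolding LU by (rule basic_set_forall_exists[OF U])
        ultimately show ?thesis
          using LD' unfolding D'_def by simp
      qed
    qed
  qed
  then show ?thesis
    using assms(2) by blast
qed

theorem theorem2p11:
  fixes r :: "'o rel" and \<alpha> :: 'o
  assumes "Well_order r" and "\<alpha> \<in> Field r"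
  shows "L_set r \<alpha> = Gab_iter r \<alpha> (trivial_intervals :: 'a::idiom set set)"
  using hierarchy_invariant[OF assms] by blast

end
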